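(* Let $\mathscr{H}$ be a complex Hilbert space, let $T,S\in\mathbb{B}(\mathscr{H})$ and let $\varepsilon\in[0,1)$. Then $T\perp^{\varepsilon}_{\omega}S$ if and only if $$\inf_{\theta\in[0,2\pi)}D^{\theta}_{\omega}(T,S)\geq-\varepsilon\,\omega(T)\,\omega(S).$$
   Context: $\mathbb{B}(\mathscr{H})$ is the algebra of all bounded linear operators on $\mathscr{H}$. The numerical radius of $T\in\mathbb{B}(\mathscr{H})$ is $\omega(T)=\sup\{|\langle Tx,x\rangle|: x\in\mathscr{H},\ \|x\|=1\}$, and $\omega^2(A)=(\omega(A))^2$. The relation $T\perp^{\varepsilon}_{\omega}S$ ($T$ is approximate numerical radius orthogonal to $S$) means $$\omega^2(T+\lambda S)\geq\omega^2(T)-2\varepsilon\,\omega(T)\,\omega(\lambda S)\quad\text{for all }\lambda\in\mathbb{C}.$$ For $\theta\in[0,2\pi)$, the numerical radius derivation is $$D^{\theta}_{\omega}(T,S)=\lim_{r\to0^+}\frac{\omega^2(T+re^{i\theta}S)-\omega^2(T)}{2r};$$ this limit exists because $r\mapsto\omega^2(T+re^{i\theta}S)$ is a convex function on $\mathbb{R}$. *)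

theory Defs
  imports Complex_Main
begin

text \<open>
  Complex inner product spaces as a type class on top of the real normed spaces of
  \<^theory>\<open>HOL.Real_Vector_Spaces\<close>: the real scalar multiplication is required to be the
  restriction of the complex one, and the norm is the one induced by the inner product (this
  also makes the inner product positive definite).  The inner product is linear in its first
  argument.
\<close>

class complex_inner = real_normed_vector +
  fixes scaleC :: "complex \<Rightarrow> 'a \<Rightarrow> 'a" (infixr \<open>*\<^sub>C\<close> 75)
    and cinner :: "'a \<Rightarrow> 'a \<Rightarrow> complex"
  assumes scaleC_add_right: "c *\<^sub>C (x + y) = c *\<^sub>C x + c *\<^sub>C y"
    and scaleC_add_left: "(c + d) *\<^sub>C x = c *\<^sub>C x + d *\<^sub>C x"
    and scaleC_scaleC: "c *\<^sub>C d *\<^sub>C x = (c * d) *\<^sub>C x"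
    and scaleC_of_real: "complex_of_real r *\<^sub>C x = r *\<^sub>R x"
    and cinner_commute: "cinner x y = cnj (cinner y x)"
    and cinner_add_left: "cinner (x + y) z = cinner x z + cinner y z"
    and cinner_scaleC_left: "cinner (c *\<^sub>C x) y = c * cinner x y"
    and cinner_self: "cinner x x = complex_of_real ((norm x)\<^sup>2)"

class chilbert_space = complex_inner + complete_space

definition bounded_clinear :: "('a::complex_inner \<Rightarrow> 'a) \<Rightarrow> bool" where
  "bounded_clinear T \<longleftrightarrow> bounded_linear T \<and> (\<forall>c x. T (c *\<^sub>C x) = c *\<^sub>C T x)"

text \<open>
  For a bounded operator on a nonzero space the set below is nonempty and bounded above.  On
  the zero space there are no unit vectors; the value is then an unspecified constant.
\<close>

definition numerical_radius :: "('a::complex_inner \<Rightarrow> 'a) \<Rightarrow> real" where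
  "numerical_radius T = Sup {cmod (cinner (T x) x) | x. norm x = 1}"

definition approx_numerical_radius_orthogonal ::
    "real \<Rightarrow> ('a::complex_inner \<Rightarrow> 'a) \<Rightarrow> ('a \<Rightarrow> 'a) \<Rightarrow> bool" where
  "approx_numerical_radius_orthogonal \<epsilon> T S \<longleftrightarrow>
    (\<forall>c::complex. (numerical_radius (\<lambda>x. T x + c *\<^sub>C S x))\<^sup>2
       \<ge> (numerical_radius T)\<^sup>2
         - 2 * \<epsilon> * numerical_radius T * numerical_radius (\<lambda>x. c *\<^sub>C S x))"

definition numerical_radius_derivation ::
    "real \<Rightarrow> ('a::complex_inner \<Rightarrow> 'a) \<Rightarrow> ('a \<Rightarrow> 'a) \<Rightarrow> real" where
  "numerical_radius_derivation \<theta> T S =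
    Lim (at_right 0) (\<lambda>r::real.
      ((numerical_radius (\<lambda>x. T x + (complex_of_real r * cis \<theta>) *\<^sub>C S x))\<^sup>2
        - (numerical_radius T)\<^sup>2) / (2 * r))"

end

theory Submission
  imports Defs
begin

text \<open>
  Fix a direction \<open>\<theta>\<close> and let \<open>q r\<close> be the difference quotient of
  \<open>r \<mapsto> \<omega>\<^sup>2(T + r e\<^sup>i\<^sup>\<theta> S)\<close> at \<open>0\<close>, divided by two.  As the numerical radius is a seminorm on
  bounded operators, its square is convex along the ray, so \<open>q\<close> is nondecreasing on \<open>r > 0\<close>
  (\<open>difference_quotient_mono\<close>).  The reverse triangle inequality bounds \<open>q\<close> from below by
  \<open>- \<omega>(T) \<omega>(S)\<close>, uniformly in \<open>r\<close> and \<open>\<theta>\<close> (\<open>difference_quotient_ge\<close>).  A nondecreasing function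
  that is bounded below converges at \<open>0\<close> from the right to its infimum, so the derivation is the
  infimum of \<open>q\<close> over \<open>r > 0\<close>.

  By homogeneity, the orthogonality condition for \<open>\<lambda> = r e\<^sup>i\<^sup>\<theta>\<close>, \<open>r > 0\<close>, says exactly
  \<open>q r \<ge> - \<epsilon> \<omega>(T) \<omega>(S)\<close>.  Hence it holds for all \<open>\<lambda> \<noteq> 0\<close> if and only if every derivation, as an
  infimum of such quotients, satisfies the same bound.  The uniform lower bound also ensures that
  the infimum over \<open>\<theta>\<close> is taken over a set that is bounded below, as is required for the
  infimum in the reals to be a lower bound at all.

  On the zero space the supremum in the definition of \<open>\<omega>\<close> runs over the empty set, so \<open>\<omega>\<close> is one
  and the same constant for all operators; there both sides of the equivalence hold.
\<close>

section \<open>The inner product and the numerical range\<close>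

lemma power2_norm_scaleC:
  "(norm (c *\<^sub>C x))\<^sup>2 = (cmod c)\<^sup>2 * (norm (x::'a::complex_inner))\<^sup>2"
proof -
  have "complex_of_real ((norm (c *\<^sub>C x))\<^sup>2) = c * cnj c * complex_of_real ((norm x)\<^sup>2)"
    by (metis cinner_commute cinner_scaleC_left cinner_self complex_cnj_mult mult.assoc
        complex_cnj_complex_of_real)
  also have "\<dots> = complex_of_real ((cmod c)\<^sup>2 * (norm x)\<^sup>2)"
    by (simp add: complex_norm_square[symmetric])
  finally show ?thesis
    using of_real_eq_iff by blast
qed

lemma norm_scaleC: "norm (c *\<^sub>C x) = cmod c * norm (x::'a::complex_inner)"
  by (rule power2_eq_imp_eq) (simp_all add: power2_norm_scaleC power_mult_distrib)

lemma scaleC_zero_left: "0 *\<^sub>C x = (0::'a::complex_inner)"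
  using norm_scaleC[of 0 x] by simp

lemma bounded_linear_scaleC_right:
  "bounded_linear (\<lambda>x::'a::complex_inner. c *\<^sub>C x)"
proof (rule bounded_linear_intro[where K = "cmod c"])
  show "c *\<^sub>C (r *\<^sub>R x) = r *\<^sub>R (c *\<^sub>C x)" for r and x :: 'a
    by (metis scaleC_of_real scaleC_scaleC mult.commute)
qed (simp_all add: scaleC_add_right norm_scaleC mult.commute)

lemmas bounded_linear_scaleC = bounded_linear_compose[OF bounded_linear_scaleC_right]

text \<open>
  Cauchy--Schwarz against a unit vector: the vector \<open>y - \<langle>y, x\<rangle> x\<close> has squared norm
  \<open>\<parallel>y\<parallel>\<^sup>2 - \<bar>\<langle>y, x\<rangle>\<bar>\<^sup>2\<close>.
\<close>

lemma cmod_cinner_le_norm: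
  fixes x y :: "'a::complex_inner"
  assumes "norm x = 1"
  shows "cmod (cinner y x) \<le> norm y"
proof -
  define a where "a = cinner y x"
  define z where "z = y + (- a) *\<^sub>C x"
  have xx: "cinner x x = 1"
    using assms by (simp add: cinner_self)
  have zx: "cinner z x = 0"
    by (simp add: z_def cinner_add_left cinner_scaleC_left xx a_def)
  hence xz: "cinner x z = 0"
    by (metis cinner_commute complex_cnj_zero)
  have "complex_of_real ((norm z)\<^sup>2) = cinner y z"
    by (subst cinner_self[symmetric], subst (1) z_def)
      (simp add: cinner_add_left cinner_scaleC_left xz)
  also have "\<dots> = cnj (cinner y y + (- a) * cinner x y)"
    by (metis cinner_commute z_def cinner_add_left cinner_scaleC_left)
  also have "\<dots> = complex_of_real ((norm y)\<^sup>2) - cnj a * a"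
    by (simp add: cinner_self a_def cinner_commute[of x y])
  also have "\<dots> = complex_of_real ((norm y)\<^sup>2 - (cmod a)\<^sup>2)"
    by (simp add: complex_norm_square[symmetric] mult.commute)
  finally have "(norm z)\<^sup>2 = (norm y)\<^sup>2 - (cmod a)\<^sup>2"
    using of_real_eq_iff by blast
  hence "(cmod a)\<^sup>2 \<le> (norm y)\<^sup>2"
    by (metis diff_ge_0_iff_ge zero_le_power2)
  thus ?thesis
    unfolding a_def by (rule power2_le_imp_le) simp
qed

lemma cmod_cinner_le_numerical_radius:
  fixes T :: "'a::complex_inner \<Rightarrow> 'a"
  assumes "bounded_linear T" and "norm x = 1"
  shows "cmod (cinner (T x) x) \<le> numerical_radius T"
  unfolding numerical_radius_def
proof (rule cSup_upper)
  obtain K where K: "\<And>x. norm (T x) \<le> norm x * K"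
    using bounded_linear.bounded[OF assms(1)] by blast
  have "cmod (cinner (T x) x) \<le> K" if "norm x = 1" for x
    using cmod_cinner_le_norm[OF that, of "T x"] K[of x] that by simp
  thus "bdd_above {cmod (cinner (T x) x) | x. norm x = 1}"
    by (auto intro!: bdd_aboveI)
qed (use assms(2) in blast)

lemma numerical_radius_le:
  fixes T :: "'a::complex_inner \<Rightarrow> 'a"
  assumes "\<exists>x::'a. norm x = 1"
    and "\<And>x. norm x = 1 \<Longrightarrow> cmod (cinner (T x) x) \<le> b"
  shows "numerical_radius T \<le> b"
  unfolding numerical_radius_def using assms by (intro cSup_least) auto

section \<open>The numerical radius as a seminorm\<close>

lemma numerical_radius_nonneg:
  fixes T :: "'a::complex_inner \<Rightarrow> 'a"
  assumes "\<exists>x::'a. norm x = 1" and "bounded_linear T"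
  shows "0 \<le> numerical_radius T"
  using assms cmod_cinner_le_numerical_radius norm_ge_zero order_trans by blast

lemma numerical_radius_scaleC:
  fixes T :: "'a::complex_inner \<Rightarrow> 'a"
  assumes unit: "\<exists>x::'a. norm x = 1" and T: "bounded_linear T"
  shows "numerical_radius (\<lambda>x. c *\<^sub>C T x) = cmod c * numerical_radius T"
proof (rule antisym)
  show "numerical_radius (\<lambda>x. c *\<^sub>C T x) \<le> cmod c * numerical_radius T"
    by (rule numerical_radius_le[OF unit])
      (simp add: cinner_scaleC_left norm_mult mult_left_mono cmod_cinner_le_numerical_radius[OF T])
  show "cmod c * numerical_radius T \<le> numerical_radius (\<lambda>x. c *\<^sub>C T x)"
  proof (cases "c = 0")
    case True
    thus ?thesis
      using numerical_radius_nonneg[OF unit bounded_linear_scaleC[OF T]] by simp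
  next
    case False
    have "numerical_radius T \<le> numerical_radius (\<lambda>x. c *\<^sub>C T x) / cmod c"
    proof (rule numerical_radius_le[OF unit])
      fix x :: 'a
      assume "norm x = 1"
      from cmod_cinner_le_numerical_radius[OF bounded_linear_scaleC[OF T] this, of c]
      show "cmod (cinner (T x) x) \<le> numerical_radius (\<lambda>x. c *\<^sub>C T x) / cmod c"
        using False by (simp add: cinner_scaleC_left norm_mult field_simps)
    qed
    thus ?thesis
      using False by (simp add: field_simps)
  qed
qed

lemma numerical_radius_add_le:
  fixes T S :: "'a::complex_inner \<Rightarrow> 'a"
  assumes unit: "\<exists>x::'a. norm x = 1" and T: "bounded_linear T" and S: "bounded_linear S"
  shows "numerical_radius (\<lambda>x. T x + S x) \<le> numerical_radius T + numerical_radius S"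
proof (rule numerical_radius_le[OF unit])
  fix x :: 'a
  assume x: "norm x = 1"
  show "cmod (cinner (T x + S x) x) \<le> numerical_radius T + numerical_radius S"
    unfolding cinner_add_left
    using cmod_cinner_le_numerical_radius[OF T x] cmod_cinner_le_numerical_radius[OF S x]
    by (meson add_mono norm_triangle_le)
qed

lemma numerical_radius_diff_le:
  fixes T S :: "'a::complex_inner \<Rightarrow> 'a"
  assumes unit: "\<exists>x::'a. norm x = 1" and T: "bounded_linear T" and S: "bounded_linear S"
  shows "numerical_radius T - cmod c * numerical_radius S
    \<le> numerical_radius (\<lambda>x. T x + c *\<^sub>C S x)"
proof -
  have eq: "T = (\<lambda>x. (T x + c *\<^sub>C S x) + (- c) *\<^sub>C S x)"
    by (simp add: add.assoc scaleC_add_left[symmetric] scaleC_zero_left)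
  have "numerical_radius T
      \<le> numerical_radius (\<lambda>x. T x + c *\<^sub>C S x) + numerical_radius (\<lambda>x. (- c) *\<^sub>C S x)"
    by (subst (1) eq, rule numerical_radius_add_le[OF unit])
      (intro bounded_linear_add bounded_linear_scaleC T S)+
  thus ?thesis
    by (simp add: numerical_radius_scaleC[OF unit S])
qed

lemma numerical_radius_convex_along_ray:
  fixes T S :: "'a::complex_inner \<Rightarrow> 'a"
  assumes unit: "\<exists>x::'a. norm x = 1" and T: "bounded_linear T" and S: "bounded_linear S"
    and t: "0 \<le> t" "t \<le> 1"
  shows "numerical_radius (\<lambda>x. T x + (complex_of_real t * c) *\<^sub>C S x)
    \<le> (1 - t) * numerical_radius T + t * numerical_radius (\<lambda>x. T x + c *\<^sub>C S x)"
proof -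
  let ?U = "\<lambda>x. T x + c *\<^sub>C S x"
  have U: "bounded_linear ?U"
    by (intro bounded_linear_add bounded_linear_scaleC T S)
  have eq: "(\<lambda>x. T x + (complex_of_real t * c) *\<^sub>C S x)
      = (\<lambda>x. complex_of_real (1 - t) *\<^sub>C T x + complex_of_real t *\<^sub>C ?U x)"
    by (simp only: scaleC_scaleC[symmetric] scaleC_of_real) (simp add: algebra_simps)
  have "numerical_radius (\<lambda>x. T x + (complex_of_real t * c) *\<^sub>C S x)
      \<le> numerical_radius (\<lambda>x. complex_of_real (1 - t) *\<^sub>C T x)
        + numerical_radius (\<lambda>x. complex_of_real t *\<^sub>C ?U x)"
    unfolding eq
    by (intro numerical_radius_add_le[OF unit] bounded_linear_scaleC T U)
  also have "\<dots> = (1 - t) * numerical_radius T + t * numerical_radius ?U"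
    unfolding numerical_radius_scaleC[OF unit T] numerical_radius_scaleC[OF unit U] norm_of_real
    using t by simp
  finally show ?thesis .
qed

section \<open>Difference quotients of the squared numerical radius\<close>

text \<open>
  For \<open>s \<le> r\<close> the point \<open>T + s e\<^sup>i\<^sup>\<theta> S\<close> is the convex combination of \<open>T\<close> and \<open>T + r e\<^sup>i\<^sup>\<theta> S\<close> with
  weight \<open>t = s / r\<close>, and \<open>(1 - t) a\<^sup>2 + t b\<^sup>2 - ((1 - t) a + t b)\<^sup>2 = t (1 - t) (a - b)\<^sup>2 \<ge> 0\<close>.
\<close>

lemma difference_quotient_mono:
  fixes T S :: "'a::complex_inner \<Rightarrow> 'a"
  assumes unit: "\<exists>x::'a. norm x = 1" and T: "bounded_linear T" and S: "bounded_linear S"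
    and "0 < s" "s \<le> r"
  shows "((numerical_radius (\<lambda>x. T x + (complex_of_real s * u) *\<^sub>C S x))\<^sup>2
        - (numerical_radius T)\<^sup>2) / (2 * s)
    \<le> ((numerical_radius (\<lambda>x. T x + (complex_of_real r * u) *\<^sub>C S x))\<^sup>2
        - (numerical_radius T)\<^sup>2) / (2 * r)"
proof -
  define t where "t = s / r"
  define a where "a = numerical_radius T"
  define b where "b = numerical_radius (\<lambda>x. T x + (complex_of_real r * u) *\<^sub>C S x)"
  define m where "m = numerical_radius (\<lambda>x. T x + (complex_of_real s * u) *\<^sub>C S x)"
  have r: "0 < r" and t: "0 \<le> t" "t \<le> 1" and s: "s = t * r"
    using assms(4,5) by (auto simp: t_def)
  have "0 \<le> m"
    unfolding m_def
    by (intro numerical_radius_nonneg[OF unit] bounded_linear_add bounded_linear_scaleC T S)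
  moreover have "m \<le> (1 - t) * a + t * b"
    using numerical_radius_convex_along_ray[OF unit T S t, of "complex_of_real r * u"]
    by (simp add: a_def b_def m_def s mult.assoc)
  ultimately have "m\<^sup>2 \<le> ((1 - t) * a + t * b)\<^sup>2"
    by (intro power_mono)
  also have "\<dots> = (1 - t) * a\<^sup>2 + t * b\<^sup>2 - t * (1 - t) * (a - b)\<^sup>2"
    by (simp add: power2_eq_square algebra_simps)
  also have "\<dots> \<le> (1 - t) * a\<^sup>2 + t * b\<^sup>2"
    using t by simp
  finally have "m\<^sup>2 - a\<^sup>2 \<le> t * (b\<^sup>2 - a\<^sup>2)"
    by (simp add: algebra_simps)
  hence "(m\<^sup>2 - a\<^sup>2) / (2 * s) \<le> t * (b\<^sup>2 - a\<^sup>2) / (2 * s)"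
    using assms(4) by (intro divide_right_mono) auto
  also have "\<dots> = (b\<^sup>2 - a\<^sup>2) / (2 * r)"
    using assms(4) s by auto
  finally show ?thesis
    by (simp add: a_def b_def m_def)
qed

text \<open>
  With \<open>d = r \<omega>(S)\<close> and \<open>a = \<omega>(T)\<close>, squaring \<open>a - d \<le> \<omega>(T + r u S)\<close> is legitimate when \<open>d \<le> a\<close>;
  otherwise the claimed bound \<open>a\<^sup>2 - 2 a d\<close> is at most \<open>- a\<^sup>2 \<le> 0\<close>.
\<close>

lemma difference_quotient_ge:
  fixes T S :: "'a::complex_inner \<Rightarrow> 'a"
  assumes unit: "\<exists>x::'a. norm x = 1" and T: "bounded_linear T" and S: "bounded_linear S"
    and "0 < r" and "cmod u = 1"
  shows "- (numerical_radius T * numerical_radius S)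
    \<le> ((numerical_radius (\<lambda>x. T x + (complex_of_real r * u) *\<^sub>C S x))\<^sup>2
        - (numerical_radius T)\<^sup>2) / (2 * r)"
proof -
  define a where "a = numerical_radius T"
  define d where "d = r * numerical_radius S"
  define m where "m = numerical_radius (\<lambda>x. T x + (complex_of_real r * u) *\<^sub>C S x)"
  have a: "0 \<le> a"
    using numerical_radius_nonneg[OF unit T] by (simp add: a_def)
  have m: "a - d \<le> m"
    using numerical_radius_diff_le[OF unit T S, of "complex_of_real r * u"] assms(4,5)
    by (simp add: a_def d_def m_def norm_mult)
  have "a\<^sup>2 - 2 * a * d \<le> m\<^sup>2"
  proof (cases "d \<le> a")
    case True
    hence "(a - d)\<^sup>2 \<le> m\<^sup>2"
      using m by (intro power_mono) auto
    moreover have "(a - d)\<^sup>2 = a\<^sup>2 - 2 * a * d + d\<^sup>2"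
      by (simp add: power2_eq_square algebra_simps)
    ultimately show ?thesis
      using zero_le_power2[of d] by linarith
  next
    case False
    hence "a * a \<le> a * d"
      using a by (intro mult_left_mono) auto
    hence "a\<^sup>2 - 2 * a * d \<le> 0"
      using zero_le_square[of a] unfolding power2_eq_square mult.assoc by linarith
    thus ?thesis
      using zero_le_power2[of m] by linarith
  qed
  thus ?thesis
    using assms(4) by (simp add: a_def d_def m_def field_simps)
qed

text \<open>
  The limit is the infimum of the values to the right of \<open>a\<close>: if \<open>f r\<close> is close to the infimum
  for one \<open>r\<close>, then by monotonicity so is every value between \<open>a\<close> and \<open>r\<close>.
\<close>

lemma tendsto_at_right_mono_bounded_below:
  fixes f :: "real \<Rightarrow> real"
  assumes mono: "\<And>s r. a < s \<Longrightarrow> s \<le> r \<Longrightarrow> f s \<le> f r"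
    and below: "\<And>r. a < r \<Longrightarrow> b \<le> f r"
  shows "\<exists>l. (f \<longlongrightarrow> l) (at_right a) \<and> (\<forall>r>a. l \<le> f r)"
proof (intro exI conjI allI impI)
  let ?l = "INF r\<in>{a<..}. f r"
  have bdd: "bdd_below (f ` {a<..})"
    using below by (auto intro!: bdd_belowI)
  show lower: "?l \<le> f r" if "a < r" for r
    using bdd that by (intro cINF_lower) auto
  show "(f \<longlongrightarrow> ?l) (at_right a)"
  proof (rule order_tendstoI)
    fix y
    assume "y < ?l"
    hence "y < f r" if "a < r" for r
      using lower[OF that] by linarith
    thus "\<forall>\<^sub>F r in at_right a. y < f r"
      by (auto simp: eventually_at_right_field intro: exI[of _ "a + 1"])
  next
    fix y
    assume "?l < y"
    then obtain r where r: "a < r" "f r < y"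
      using bdd by (auto simp: cINF_less_iff)
    hence "f s < y" if "a < s" "s < r" for s
      using mono[of s r] that by simp
    thus "\<forall>\<^sub>F r in at_right a. f r < y"
      using r(1) unfolding eventually_at_right_field by blast
  qed
qed

text \<open>
  The derivation is defined by \<open>Lim\<close>, which is arbitrary when there is no limit.  Monotonicity and
  boundedness of the quotients give the limit, and with it access to the value.
\<close>

lemma numerical_radius_derivation_tendsto:
  fixes T S :: "'a::complex_inner \<Rightarrow> 'a"
  assumes unit: "\<exists>x::'a. norm x = 1" and T: "bounded_linear T" and S: "bounded_linear S"
  defines "q \<equiv> \<lambda>\<theta> r. ((numerical_radius (\<lambda>x. T x + (complex_of_real r * cis \<theta>) *\<^sub>C S x))\<^sup>2
        - (numerical_radius T)\<^sup>2) / (2 * r)"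
  shows "(q \<theta> \<longlongrightarrow> numerical_radius_derivation \<theta> T S) (at_right 0)"
    and "0 < r \<Longrightarrow> numerical_radius_derivation \<theta> T S \<le> q \<theta> r"
proof -
  have "\<exists>l. (q \<theta> \<longlongrightarrow> l) (at_right 0) \<and> (\<forall>r>0. l \<le> q \<theta> r)"
  proof (rule tendsto_at_right_mono_bounded_below)
    show "q \<theta> s \<le> q \<theta> r" if "0 < s" "s \<le> r" for s r
      unfolding q_def by (rule difference_quotient_mono[OF unit T S that])
    show "- (numerical_radius T * numerical_radius S) \<le> q \<theta> r" if "0 < r" for r
      unfolding q_def by (rule difference_quotient_ge[OF unit T S that]) simp
  qed
  then obtain l where l: "(q \<theta> \<longlongrightarrow> l) (at_right 0)" and le: "\<And>r. 0 < r \<Longrightarrow> l \<le> q \<theta> r"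
    by blast
  have "numerical_radius_derivation \<theta> T S = l"
    unfolding numerical_radius_derivation_def
    using tendsto_Lim[OF trivial_limit_at_right_real l] by (simp add: q_def)
  thus "(q \<theta> \<longlongrightarrow> numerical_radius_derivation \<theta> T S) (at_right 0)"
    and "0 < r \<Longrightarrow> numerical_radius_derivation \<theta> T S \<le> q \<theta> r"
    using l le by simp_all
qed

section \<open>Characterization of approximate numerical radius orthogonality\<close>

text \<open>
  The principal argument lies in \<open>(-\<pi>, \<pi>]\<close>, so a negative one is shifted by a full turn.
\<close>

lemma polar_form_obtain:
  obtains \<theta> where "\<theta> \<in> {0..<2 * pi}" and "c = complex_of_real (cmod c) * cis \<theta>"
proof (cases "0 \<le> Arg c")
  case True
  thus ?thesis
    using that[of "Arg c"] Arg_bounded[of c] rcis_cmod_Arg[of c] pi_gt_zero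
    by (simp add: rcis_def)
next
  case False
  have "cis (Arg c + 2 * pi) = cis (Arg c)"
    by (simp add: cis.ctr)
  thus ?thesis
    using that[of "Arg c + 2 * pi"] False Arg_bounded[of c] rcis_cmod_Arg[of c]
    by (simp add: rcis_def)
qed

text \<open>
  This is the reformulation of orthogonality as a bound on difference quotients; \<open>\<lambda> = 0\<close> drops
  out because its condition \<open>\<omega>\<^sup>2(T) \<ge> \<omega>\<^sup>2(T)\<close> is void.
\<close>

lemma approx_numerical_radius_orthogonal_iff_difference_quotient:
  fixes T S :: "'a::complex_inner \<Rightarrow> 'a"
  assumes unit: "\<exists>x::'a. norm x = 1" and T: "bounded_linear T" and S: "bounded_linear S"
  shows "approx_numerical_radius_orthogonal \<epsilon> T S \<longleftrightarrow>
    (\<forall>\<theta>\<in>{0..<2 * pi}. \<forall>r>0. - \<epsilon> * numerical_radius T * numerical_radius S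
      \<le> ((numerical_radius (\<lambda>x. T x + (complex_of_real r * cis \<theta>) *\<^sub>C S x))\<^sup>2
          - (numerical_radius T)\<^sup>2) / (2 * r))"
    (is "_ \<longleftrightarrow> (\<forall>\<theta>\<in>_. \<forall>r>0. ?Q \<theta> r)")
proof -
  let ?P = "\<lambda>c. (numerical_radius T)\<^sup>2
      - 2 * \<epsilon> * numerical_radius T * (cmod c * numerical_radius S)
    \<le> (numerical_radius (\<lambda>x. T x + c *\<^sub>C S x))\<^sup>2"
  have PQ: "?P (complex_of_real r * cis \<theta>) \<longleftrightarrow> ?Q \<theta> r" if "0 < r" for r \<theta>
    using that by (simp add: norm_mult pos_le_divide_eq algebra_simps)
  have P0: "?P 0"
    by (simp add: scaleC_zero_left)
  have "(\<forall>c. ?P c) \<longleftrightarrow> (\<forall>\<theta>\<in>{0..<2 * pi}. \<forall>r>0. ?Q \<theta> r)"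
  proof (intro iffI allI ballI impI)
    fix c
    assume Q: "\<forall>\<theta>\<in>{0..<2 * pi}. \<forall>r>0. ?Q \<theta> r"
    obtain \<theta> where \<theta>: "\<theta> \<in> {0..<2 * pi}" "c = complex_of_real (cmod c) * cis \<theta>"
      by (rule polar_form_obtain)
    show "?P c"
    proof (cases "c = 0")
      case True
      thus ?thesis using P0 by simp
    next
      case False
      hence "?P (complex_of_real (cmod c) * cis \<theta>)"
        using Q \<theta>(1) PQ[of "cmod c" \<theta>] by simp
      thus ?thesis using \<theta>(2) by simp
    qed
  qed (use PQ in blast)
  thus ?thesis
    unfolding approx_numerical_radius_orthogonal_def numerical_radius_scaleC[OF unit S] .
qed

theorem theorem3p1:
  fixes T S :: "'a::chilbert_space \<Rightarrow> 'a" and \<epsilon> :: real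
  assumes "bounded_clinear T" and "bounded_clinear S"
    and "0 \<le> \<epsilon>" and "\<epsilon> < 1"
  shows "approx_numerical_radius_orthogonal \<epsilon> T S \<longleftrightarrow>
    (INF \<theta>\<in>{0..<2 * pi}. numerical_radius_derivation \<theta> T S)
      \<ge> - \<epsilon> * numerical_radius T * numerical_radius S"
proof (cases "\<exists>x::'a. norm x = 1")
  case False
  \<comment> \<open>The space is zero, and the value of \<open>Sup {}\<close> is immaterial.\<close>
  define k where "k = (Sup {} :: real)"
  have const: "numerical_radius A = k" for A :: "'a \<Rightarrow> 'a"
    using False by (simp add: numerical_radius_def k_def)
  have D: "numerical_radius_derivation \<theta> T S = 0" for \<theta>
    unfolding numerical_radius_derivation_def const
    by (simp add: tendsto_Lim)
  have "0 \<le> \<epsilon> * k * k"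
    using assms(3) by (simp add: mult.assoc)
  thus ?thesis
    using pi_gt_zero by (simp add: approx_numerical_radius_orthogonal_def const D)
next
  case unit: True
  have T: "bounded_linear T" and S: "bounded_linear S"
    using assms(1,2) by (auto simp: bounded_clinear_def)
  let ?b = "- \<epsilon> * numerical_radius T * numerical_radius S"
  let ?D = "\<lambda>\<theta>. numerical_radius_derivation \<theta> T S"
  let ?q = "\<lambda>\<theta> r. ((numerical_radius (\<lambda>x. T x + (complex_of_real r * cis \<theta>) *\<^sub>C S x))\<^sup>2
        - (numerical_radius T)\<^sup>2) / (2 * r)"
  have tendsto: "(?q \<theta> \<longlongrightarrow> ?D \<theta>) (at_right 0)" for \<theta>
    by (rule numerical_radius_derivation_tendsto(1)[OF unit T S])
  have le: "?D \<theta> \<le> ?q \<theta> r" if "0 < r" for \<theta> r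
    by (rule numerical_radius_derivation_tendsto(2)[OF unit T S that])
  have limit_ge: "b \<le> ?D \<theta>" if "\<And>r. 0 < r \<Longrightarrow> b \<le> ?q \<theta> r" for b \<theta>
    by (rule tendsto_lowerbound[OF tendsto _ trivial_limit_at_right_real])
      (use that in \<open>auto simp: eventually_at_right_field intro: exI[of _ 1]\<close>)
  have "- (numerical_radius T * numerical_radius S) \<le> ?D \<theta>" for \<theta>
    by (rule limit_ge, rule difference_quotient_ge[OF unit T S]) simp_all
  hence bdd: "bdd_below (?D ` {0..<2 * pi})"
    by (auto intro!: bdd_belowI)
  have "(\<forall>r>0. ?b \<le> ?q \<theta> r) \<longleftrightarrow> ?b \<le> ?D \<theta>" for \<theta>
    using limit_ge[of ?b \<theta>] le[of _ \<theta>] order_trans by blast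
  hence "approx_numerical_radius_orthogonal \<epsilon> T S \<longleftrightarrow> (\<forall>\<theta>\<in>{0..<2 * pi}. ?b \<le> ?D \<theta>)"
    unfolding approx_numerical_radius_orthogonal_iff_difference_quotient[OF unit T S] by simp
  also have "\<dots> \<longleftrightarrow> ?b \<le> (INF \<theta>\<in>{0..<2 * pi}. ?D \<theta>)"
    using bdd pi_gt_zero by (intro le_cINF_iff[symmetric]) auto
  finally show ?thesis .
qed

end
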